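(* The Kronecker category $\mathcal{K}$ does not admit a universal grading.
   Context: Let $k$ be a field. The Kronecker category $\mathcal{K}$ is the $k$-category with two objects $x$ and $y$ whose endomorphism algebras are $k$, with no non-zero morphisms from $y$ to $x$, and with the space ${}_y\mathcal{K}_x$ of morphisms from $x$ to $y$ two-dimensional. A $k$-category is a small category $\mathcal{B}$ whose morphism sets are $k$-vector spaces and whose composition is bilinear. Its set of objects is $\mathcal{B}_0$, and ${}_{b'}\mathcal{B}_b$ is the space of morphisms with source $b$ and target $b'$. A grading $X$ of $\mathcal{B}$ by a group $\Gamma(X)$ (its structural group) is a direct sum decomposition ${}_{b'}\mathcal{B}_b=\bigoplus_{s\in\Gamma(X)}X^s{}_{b'}\mathcal{B}_b$ for all objects $b,b'$, with $(X^t{}_{b''}\mathcal{B}_{b'})(X^s{}_{b'}\mathcal{B}_b)\subset X^{ts}{}_{b''}\mathcal{B}_b$. A non-zero $f\in X^s{}_{b'}\mathcal{B}_b$ is called $X$-homogeneous of degree $\deg_X f=s$. A virtual morphism is a pair $(f,\epsilon)$ with $f$ a non-zero morphism and $\epsilon=\pm1$; $(f,1)$ has the source and target of $f$, and for $(f,-1)$ they are reversed. A walk from $b$ to $b'$ is a sequence $w=(f_n,\epsilon_n),\dots,(f_1,\epsilon_1)$ of virtual morphisms such that the source of $(f_1,\epsilon_1)$ is $b$, the target of each $(f_i,\epsilon_i)$ is the source of $(f_{i+1},\epsilon_{i+1})$, and the target of $(f_n,\epsilon_n)$ is $b'$. It is $X$-homogeneous if all $f_i$ are, and then $\deg_X w=(\deg_X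 f_n)^{\epsilon_n}\cdots(\deg_X f_1)^{\epsilon_1}$. The set of $X$-homogeneous walks from $b$ to $b'$ is ${}_{b'}HW(\mathcal{B},X)_b$. The grading $X$ is connected if $\deg_X:{}_{b'}HW(\mathcal{B},X)_b\to\Gamma(X)$ is surjective for any objects $b,b'$. For gradings $X,Y$, a $k$-linear automorphism functor $J$ of $\mathcal{B}$ is homogeneous from $X$ to $Y$ if it is the identity on objects and sends $X$-homogeneous morphisms to $Y$-homogeneous morphisms. It induces $HW(J):{}_{b'}HW(\mathcal{B},X)_b\to{}_{b'}HW(\mathcal{B},Y)_b$ by applying $J$ to each $f_i$. For connected gradings $X,Y$ of a connected $k$-category with base object $b_0$, a morphism of gradings $\mu:X\to Y$ is a group map $\mu:\Gamma(X)\to\Gamma(Y)$ for which there exists a (not necessarily unique) homogeneous automorphism $J$ from $X$ to $Y$ with $\mu\circ\deg_X=\deg_Y\circ HW(J)$ on ${}_{b_0}HW(\mathcal{B},X)_{b_0}$. A connected grading $U$ is universal if for any connected grading $X$ there is a unique morphism of gradings $U\to X$. For $\mathcal{K}$ the base object is $b_0=x$. *)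

theory Defs
  imports "HOL-Algebra.Group" "HOL-Library.Product_Plus" "HOL.Vector_Spaces"
begin

section \<open>Categories enriched over a field\<close>

text \<open>
  All morphism spaces are subspaces of one ambient vector space; any small category over a field has
  this form after replacing its morphism spaces by isomorphic copies.  The spaces are not assumed
  disjoint (they share the zero vector), so a morphism always comes with its source and target:
  \<open>Hom C b b'\<close> is the space of morphisms from \<open>b\<close> to \<open>b'\<close>, and \<open>Comp C b b' b'' g f\<close> is the
  composite of \<open>f \<in> Hom C b b'\<close> followed by \<open>g \<in> Hom C b' b''\<close>.
\<close>

record ('o, 'k, 'm) kcat =
  Obj :: "'o set"
  Hom :: "'o \<Rightarrow> 'o \<Rightarrow> 'm set"
  Scale :: "'k \<Rightarrow> 'm \<Rightarrow> 'm"
  Comp :: "'o \<Rightarrow> 'o \<Rightarrow> 'o \<Rightarrow> 'm \<Rightarrow> 'm \<Rightarrow> 'm"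
  Ident :: "'o \<Rightarrow> 'm"

locale k_category = vector_space "Scale C"
  for C :: "('o, 'k::field, 'm::ab_group_add) kcat" +
  assumes subspace_Hom: "b \<in> Obj C \<Longrightarrow> b' \<in> Obj C \<Longrightarrow> subspace (Hom C b b')"
    and Ident_closed: "b \<in> Obj C \<Longrightarrow> Ident C b \<in> Hom C b b"
    and Comp_closed:
      "\<lbrakk>b \<in> Obj C; b' \<in> Obj C; b'' \<in> Obj C; f \<in> Hom C b b'; g \<in> Hom C b' b''\<rbrakk>
       \<Longrightarrow> Comp C b b' b'' g f \<in> Hom C b b''"
    and Comp_assoc:
      "\<lbrakk>b \<in> Obj C; b' \<in> Obj C; b'' \<in> Obj C; b''' \<in> Obj C;
        f \<in> Hom C b b'; g \<in> Hom C b' b''; h \<in> Hom C b'' b'''\<rbrakk>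
       \<Longrightarrow> Comp C b b'' b''' h (Comp C b b' b'' g f) = Comp C b b' b''' (Comp C b' b'' b''' h g) f"
    and Ident_left:
      "\<lbrakk>b \<in> Obj C; b' \<in> Obj C; f \<in> Hom C b b'\<rbrakk> \<Longrightarrow> Comp C b b' b' (Ident C b') f = f"
    and Ident_right:
      "\<lbrakk>b \<in> Obj C; b' \<in> Obj C; f \<in> Hom C b b'\<rbrakk> \<Longrightarrow> Comp C b b b' f (Ident C b) = f"
    and Comp_add_left:
      "\<lbrakk>b \<in> Obj C; b' \<in> Obj C; b'' \<in> Obj C;
        f \<in> Hom C b b'; g \<in> Hom C b' b''; g' \<in> Hom C b' b''\<rbrakk>
       \<Longrightarrow> Comp C b b' b'' (g + g') f = Comp C b b' b'' g f + Comp C b b' b'' g' f"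
    and Comp_add_right:
      "\<lbrakk>b \<in> Obj C; b' \<in> Obj C; b'' \<in> Obj C;
        f \<in> Hom C b b'; f' \<in> Hom C b b'; g \<in> Hom C b' b''\<rbrakk>
       \<Longrightarrow> Comp C b b' b'' g (f + f') = Comp C b b' b'' g f + Comp C b b' b'' g f'"
    and Comp_scale_left:
      "\<lbrakk>b \<in> Obj C; b' \<in> Obj C; b'' \<in> Obj C; f \<in> Hom C b b'; g \<in> Hom C b' b''\<rbrakk>
       \<Longrightarrow> Comp C b b' b'' (Scale C c g) f = Scale C c (Comp C b b' b'' g f)"
    and Comp_scale_right:
      "\<lbrakk>b \<in> Obj C; b' \<in> Obj C; b'' \<in> Obj C; f \<in> Hom C b b'; g \<in> Hom C b' b''\<rbrakk>
       \<Longrightarrow> Comp C b b' b'' g (Scale C c f) = Scale C c (Comp C b b' b'' g f)"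

text \<open>
  That the endomorphism algebra of an object is \<open>k\<close> means that the unit map \<open>c \<mapsto> c \<cdot> id\<close>, the only
  homomorphism of \<open>k\<close>-algebras from \<open>k\<close>, is bijective.
\<close>

locale kronecker_category = k_category K
  for K :: "('o, 'k::field, 'm::ab_group_add) kcat" and x y :: 'o +
  assumes objects: "Obj K = {x, y}" "x \<noteq> y"
    and End_x: "bij_betw (\<lambda>c. Scale K c (Ident K x)) UNIV (Hom K x x)"
    and End_y: "bij_betw (\<lambda>c. Scale K c (Ident K y)) UNIV (Hom K y y)"
    and Hom_y_x: "Hom K y x = {0}"
    and dim_Hom_x_y: "dim (Hom K x y) = 2"


section \<open>Gradings\<close>

definition direct_sum_decomposition ::
    "('k::field \<Rightarrow> 'm::ab_group_add \<Rightarrow> 'm) \<Rightarrow> 'm set \<Rightarrow> 's set \<Rightarrow> ('s \<Rightarrow> 'm set) \<Rightarrow> bool" where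
  "direct_sum_decomposition sc V S W \<longleftrightarrow>
     (\<forall>s\<in>S. module.subspace sc (W s)) \<and>
     module.span sc (\<Union>s\<in>S. W s) = V \<and>
     (\<forall>F w. finite F \<and> F \<subseteq> S \<and> (\<forall>s\<in>F. w s \<in> W s) \<and> sum w F = 0 \<longrightarrow> (\<forall>s\<in>F. w s = 0))"

record ('o, 'm, 'g) grading =
  Gam :: "'g monoid"
  Piece :: "'g \<Rightarrow> 'o \<Rightarrow> 'o \<Rightarrow> 'm set"

definition is_grading ::
    "('o, 'k::field, 'm::ab_group_add) kcat \<Rightarrow> ('o, 'm, 'g) grading \<Rightarrow> bool" where
  "is_grading C X \<longleftrightarrow>
     group (Gam X) \<and>
     (\<forall>b\<in>Obj C. \<forall>b'\<in>Obj C.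
        direct_sum_decomposition (Scale C) (Hom C b b') (carrier (Gam X)) (\<lambda>s. Piece X s b b')) \<and>
     (\<forall>b\<in>Obj C. \<forall>b'\<in>Obj C. \<forall>b''\<in>Obj C. \<forall>s\<in>carrier (Gam X). \<forall>t\<in>carrier (Gam X).
        \<forall>f\<in>Piece X s b b'. \<forall>g\<in>Piece X t b' b''.
          Comp C b b' b'' g f \<in> Piece X (t \<otimes>\<^bsub>Gam X\<^esub> s) b b'')"

definition homogeneous :: "('o, 'm::zero, 'g) grading \<Rightarrow> 'o \<Rightarrow> 'o \<Rightarrow> 'm \<Rightarrow> bool" where
  "homogeneous X b b' f \<longleftrightarrow> f \<noteq> 0 \<and> (\<exists>s\<in>carrier (Gam X). f \<in> Piece X s b b')"

definition degree :: "('o, 'm, 'g) grading \<Rightarrow> 'o \<Rightarrow> 'o \<Rightarrow> 'm \<Rightarrow> 'g" where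
  "degree X b b' f = (THE s. s \<in> carrier (Gam X) \<and> f \<in> Piece X s b b')"


section \<open>Walks\<close>

text \<open>\<open>VMor b b' f e\<close> is the pair \<open>(f, e)\<close> for a morphism \<open>f\<close> from \<open>b\<close> to \<open>b'\<close>.\<close>

datatype ('o, 'm) vmor = VMor (dom_of: 'o) (cod_of: 'o) (mor: 'm) (sign: int)

definition vsource :: "('o, 'm) vmor \<Rightarrow> 'o" where
  "vsource v = (if sign v = 1 then dom_of v else cod_of v)"

definition vtarget :: "('o, 'm) vmor \<Rightarrow> 'o" where
  "vtarget v = (if sign v = 1 then cod_of v else dom_of v)"

definition virtual_morphism :: "('o, 'k, 'm::zero) kcat \<Rightarrow> ('o, 'm) vmor \<Rightarrow> bool" where
  "virtual_morphism C v \<longleftrightarrow>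
     dom_of v \<in> Obj C \<and> cod_of v \<in> Obj C \<and> mor v \<in> Hom C (dom_of v) (cod_of v) \<and> mor v \<noteq> 0 \<and>
     sign v \<in> {1, -1}"

text \<open>
  \<open>walk C b b' w\<close>: \<open>w\<close> is a walk from \<open>b\<close> to \<open>b'\<close>.  The list is written in the order of composition,
  so the virtual morphism starting at \<open>b\<close> is the last entry.
\<close>

inductive walk :: "('o, 'k, 'm::zero) kcat \<Rightarrow> 'o \<Rightarrow> 'o \<Rightarrow> ('o, 'm) vmor list \<Rightarrow> bool"
  for C where
  single: "virtual_morphism C v \<Longrightarrow> walk C (vsource v) (vtarget v) [v]"
| step: "walk C b (vsource v) w \<Longrightarrow> virtual_morphism C v \<Longrightarrow> walk C b (vtarget v) (v # w)"

definition HW ::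
    "('o, 'k, 'm::zero) kcat \<Rightarrow> ('o, 'm, 'g) grading \<Rightarrow> 'o \<Rightarrow> 'o \<Rightarrow> ('o, 'm) vmor list set" where
  "HW C X b b' =
     {w. walk C b b' w \<and> (\<forall>v\<in>set w. homogeneous X (dom_of v) (cod_of v) (mor v))}"

primrec walk_degree :: "('o, 'm, 'g) grading \<Rightarrow> ('o, 'm) vmor list \<Rightarrow> 'g" where
  "walk_degree X [] = \<one>\<^bsub>Gam X\<^esub>"
| "walk_degree X (v # w) =
     (degree X (dom_of v) (cod_of v) (mor v) [^]\<^bsub>Gam X\<^esub> sign v) \<otimes>\<^bsub>Gam X\<^esub> walk_degree X w"

definition connected_grading ::
    "('o, 'k::field, 'm::ab_group_add) kcat \<Rightarrow> ('o, 'm, 'g) grading \<Rightarrow> bool" where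
  "connected_grading C X \<longleftrightarrow>
     is_grading C X \<and>
     (\<forall>b\<in>Obj C. \<forall>b'\<in>Obj C. walk_degree X ` HW C X b b' = carrier (Gam X))"


section \<open>Morphisms of gradings\<close>

definition linear_automorphism ::
    "('o, 'k::field, 'm::ab_group_add) kcat \<Rightarrow> ('o \<Rightarrow> 'o) \<Rightarrow> ('o \<Rightarrow> 'o \<Rightarrow> 'm \<Rightarrow> 'm) \<Rightarrow> bool" where
  "linear_automorphism C F J \<longleftrightarrow>
     bij_betw F (Obj C) (Obj C) \<and>
     (\<forall>b\<in>Obj C. J b b (Ident C b) = Ident C (F b)) \<and>
     (\<forall>b\<in>Obj C. \<forall>b'\<in>Obj C.
        bij_betw (J b b') (Hom C b b') (Hom C (F b) (F b')) \<and>
        (\<forall>f\<in>Hom C b b'. \<forall>g\<in>Hom C b b'. J b b' (f + g) = J b b' f + J b b' g) \<and>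
        (\<forall>c. \<forall>f\<in>Hom C b b'. J b b' (Scale C c f) = Scale C c (J b b' f))) \<and>
     (\<forall>b\<in>Obj C. \<forall>b'\<in>Obj C. \<forall>b''\<in>Obj C. \<forall>f\<in>Hom C b b'. \<forall>g\<in>Hom C b' b''.
        J b b'' (Comp C b b' b'' g f) = Comp C (F b) (F b') (F b'') (J b' b'' g) (J b b' f))"

definition homogeneous_automorphism ::
    "('o, 'k::field, 'm::ab_group_add) kcat \<Rightarrow> ('o, 'm, 'g) grading \<Rightarrow> ('o, 'm, 'h) grading
     \<Rightarrow> ('o \<Rightarrow> 'o \<Rightarrow> 'm \<Rightarrow> 'm) \<Rightarrow> bool" where
  "homogeneous_automorphism C X Y J \<longleftrightarrow>
     linear_automorphism C (\<lambda>b. b) J \<and>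
     (\<forall>b\<in>Obj C. \<forall>b'\<in>Obj C. \<forall>f. homogeneous X b b' f \<longrightarrow> homogeneous Y b b' (J b b' f))"

definition HW_map :: "('o \<Rightarrow> 'o \<Rightarrow> 'm \<Rightarrow> 'm) \<Rightarrow> ('o, 'm) vmor list \<Rightarrow> ('o, 'm) vmor list" where
  "HW_map J = map (\<lambda>v. VMor (dom_of v) (cod_of v) (J (dom_of v) (cod_of v) (mor v)) (sign v))"

text \<open>
  Membership in \<open>extensional\<close> makes equality of functions mean equality on the structural group of
  the source, as is needed to express uniqueness of a morphism.
\<close>

definition grading_morphism ::
    "('o, 'k::field, 'm::ab_group_add) kcat \<Rightarrow> 'o \<Rightarrow> ('o, 'm, 'g) grading \<Rightarrow> ('o, 'm, 'h) grading
     \<Rightarrow> ('g \<Rightarrow> 'h) \<Rightarrow> bool" where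
  "grading_morphism C b0 X Y \<mu> \<longleftrightarrow>
     \<mu> \<in> hom (Gam X) (Gam Y) \<and> \<mu> \<in> extensional (carrier (Gam X)) \<and>
     (\<exists>J. homogeneous_automorphism C X Y J \<and>
          (\<forall>w\<in>HW C X b0 b0. \<mu> (walk_degree X w) = walk_degree Y (HW_map J w)))"

text \<open>
  A formula cannot quantify over types, so the connected gradings \<open>X\<close> below have structural groups
  whose elements are lists of virtual morphisms.  Nothing is lost: by connectedness every structural
  group is a quotient of a set of such lists, and \<open>universal_grading_any_type\<close> below derives the
  universal property for gradings by groups over an arbitrary type.
\<close>

definition universal_grading ::
    "('o, 'k::field, 'm::ab_group_add) kcat \<Rightarrow> 'o \<Rightarrow> ('o, 'm, 'g) grading \<Rightarrow> bool" where
  "universal_grading C b0 U \<longleftrightarrow>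
     connected_grading C U \<and>
     (\<forall>X :: ('o, 'm, ('o, 'm) vmor list) grading.
        connected_grading C X \<longrightarrow> (\<exists>!\<mu>. grading_morphism C b0 U X \<mu>))"

section \<open>Universality for groups over an arbitrary type\<close>

lemma degree_eq:
  assumes C: "k_category C" and X: "is_grading C X" and b: "b \<in> Obj C" "b' \<in> Obj C"
    and s: "s \<in> carrier (Gam X)" "f \<in> Piece X s b b'" and nz: "f \<noteq> 0"
  shows "degree X b b' f = s"
  unfolding degree_def
proof (rule the_equality)
  show "s \<in> carrier (Gam X) \<and> f \<in> Piece X s b b'" using s by simp
next
  fix t assume t: "t \<in> carrier (Gam X) \<and> f \<in> Piece X t b b'"
  interpret k_category C by (fact C)
  have D: "direct_sum_decomposition (Scale C) (Hom C b b') (carrier (Gam X)) (\<lambda>s. Piece X s b b')"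
    using X b by (simp add: is_grading_def)
  show "t = s"
  proof (rule ccontr)
    assume ts: "t \<noteq> s"
    define w where "w = (\<lambda>u. if u = s then f else - f)"
    have "subspace (Piece X t b b')"
      using D t by (simp add: direct_sum_decomposition_def)
    then have "- f \<in> Piece X t b b'"
      using t subspace_neg by blast
    then have "\<forall>u\<in>{s, t}. w u \<in> Piece X u b b'"
      using s ts by (simp add: w_def)
    moreover have "sum w {s, t} = 0"
      using ts by (simp add: w_def)
    ultimately have "\<forall>u\<in>{s, t}. w u = 0"
      using D s t unfolding direct_sum_decomposition_def
      by (metis empty_subsetI finite.emptyI finite_insert insert_subset)
    then show False using nz by (simp add: w_def)
  qed
qed

lemma walk_objects: "walk C b b' w \<Longrightarrow> b \<in> Obj C \<and> b' \<in> Obj C"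
  by (induction rule: walk.induct) (auto simp: virtual_morphism_def vsource_def vtarget_def)

lemma walk_virtual_morphism: "walk C b b' w \<Longrightarrow> v \<in> set w \<Longrightarrow> virtual_morphism C v"
  by (induction rule: walk.induct) auto

lemma HW_map_closed:
  assumes J: "homogeneous_automorphism C X Y J" and w: "w \<in> HW C X b b'"
  shows "HW_map J w \<in> HW C Y b b'"
proof -
  define h where "h = (\<lambda>v. VMor (dom_of v) (cod_of v) (J (dom_of v) (cod_of v) (mor v)) (sign v))"
  have hJ: "HW_map J = map h" by (simp add: HW_map_def h_def)
  have src: "vsource (h v) = vsource v" "vtarget (h v) = vtarget v" for v
    by (simp_all add: h_def vsource_def vtarget_def)
  have hom: "homogeneous Y (dom_of (h v)) (cod_of (h v)) (mor (h v))"
    and vm: "virtual_morphism C (h v)"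
    if v: "virtual_morphism C v" "homogeneous X (dom_of v) (cod_of v) (mor v)" for v
  proof -
    have o: "dom_of v \<in> Obj C" "cod_of v \<in> Obj C" "mor v \<in> Hom C (dom_of v) (cod_of v)"
      using v by (auto simp: virtual_morphism_def)
    show *: "homogeneous Y (dom_of (h v)) (cod_of (h v)) (mor (h v))"
      using J o v(2) by (simp add: h_def homogeneous_automorphism_def)
    have "bij_betw (J (dom_of v) (cod_of v)) (Hom C (dom_of v) (cod_of v)) (Hom C (dom_of v) (cod_of v))"
      using J o by (simp add: homogeneous_automorphism_def linear_automorphism_def)
    then have "J (dom_of v) (cod_of v) (mor v) \<in> Hom C (dom_of v) (cod_of v)"
      using o bij_betwE by blast
    then show "virtual_morphism C (h v)"
      using v(1) * by (auto simp: h_def virtual_morphism_def homogeneous_def)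
  qed
  have "walk C b b' w" and hw: "\<forall>v\<in>set w. homogeneous X (dom_of v) (cod_of v) (mor v)"
    using w by (auto simp: HW_def)
  then have "walk C b b' (map h w)"
  proof (induction rule: walk.induct)
    case (single v)
    then have "walk C (vsource (h v)) (vtarget (h v)) [h v]"
      by (intro walk.single vm) auto
    then show ?case by (simp add: src)
  next
    case (step b v w)
    then have "walk C b (vtarget (h v)) (h v # map h w)"
      by (intro walk.step vm) (auto simp: src)
    then show ?case by (simp add: src)
  qed
  moreover have "\<forall>v\<in>set (map h w). homogeneous Y (dom_of v) (cod_of v) (mor v)"
    using hw walk_virtual_morphism[OF \<open>walk C b b' w\<close>] hom by auto
  ultimately show ?thesis by (simp add: HW_def hJ)
qed

text \<open>The grading obtained by renaming the elements of the structural group along an injection.\<close>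

definition transport ::
    "('g \<Rightarrow> 'h) \<Rightarrow> ('o, 'm, 'g) grading \<Rightarrow> ('o, 'm, 'h) grading" where
  "transport \<phi> X = (let \<psi> = inv_into (carrier (Gam X)) \<phi> in
     \<lparr>Gam = \<lparr>carrier = \<phi> ` carrier (Gam X), mult = (\<lambda>a b. \<phi> (\<psi> a \<otimes>\<^bsub>Gam X\<^esub> \<psi> b)),
             one = \<phi> \<one>\<^bsub>Gam X\<^esub>\<rparr>,
      Piece = (\<lambda>s. Piece X (\<psi> s))\<rparr>)"

context
  fixes C :: "('o, 'k::field, 'm::ab_group_add) kcat" and X :: "('o, 'm, 'g) grading"
    and \<phi> :: "'g \<Rightarrow> 'h"
  assumes C: "k_category C" and X: "is_grading C X" and inj: "inj_on \<phi> (carrier (Gam X))"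
begin

lemma carrier_transport: "carrier (Gam (transport \<phi> X)) = \<phi> ` carrier (Gam X)"
  by (simp add: transport_def Let_def)

lemma Piece_transport: "s \<in> carrier (Gam X) \<Longrightarrow> Piece (transport \<phi> X) (\<phi> s) = Piece X s"
  using inj by (simp add: transport_def Let_def)

lemma group_Gam: "group (Gam X)"
  using X by (simp add: is_grading_def)

lemma iso_transport: "\<phi> \<in> iso (Gam X) (Gam (transport \<phi> X))"
proof -
  interpret group "Gam X" by (fact group_Gam)
  show ?thesis
    using inj by (auto simp: iso_def hom_def bij_betw_def transport_def Let_def)
qed

lemma group_transport: "group (Gam (transport \<phi> X))"
proof -
  have "group ((Gam (transport \<phi> X))\<lparr>one := \<phi> \<one>\<^bsub>Gam X\<^esub>\<rparr>)"
    by (rule group.iso_imp_img_group[OF group_Gam iso_transport])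
  then show ?thesis by (simp add: transport_def Let_def)
qed

lemma mult_transport:
  "\<lbrakk>s \<in> carrier (Gam X); t \<in> carrier (Gam X)\<rbrakk>
   \<Longrightarrow> \<phi> s \<otimes>\<^bsub>Gam (transport \<phi> X)\<^esub> \<phi> t = \<phi> (s \<otimes>\<^bsub>Gam X\<^esub> t)"
  using inj by (simp add: transport_def Let_def)

lemma homogeneous_transport: "homogeneous (transport \<phi> X) b b' f = homogeneous X b b' f"
  by (auto simp: homogeneous_def carrier_transport Piece_transport)

lemma HW_transport: "HW C (transport \<phi> X) b b' = HW C X b b'"
  by (simp add: HW_def homogeneous_transport)

lemma is_grading_transport: "is_grading C (transport \<phi> X)"
proof -
  have D: "direct_sum_decomposition (Scale C) (Hom C b b') (\<phi> ` carrier (Gam X))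
             (\<lambda>s. Piece (transport \<phi> X) s b b')" if b: "b \<in> Obj C" "b' \<in> Obj C" for b b'
  proof -
    have D0: "direct_sum_decomposition (Scale C) (Hom C b b') (carrier (Gam X)) (\<lambda>s. Piece X s b b')"
      using X b by (simp add: is_grading_def)
    have ind: "\<forall>s\<in>F. w s = 0"
      if F: "finite F" "F \<subseteq> \<phi> ` carrier (Gam X)" "\<forall>s\<in>F. w s \<in> Piece (transport \<phi> X) s b b'"
        and 0: "sum w F = 0" for F w
    proof -
      obtain E where E: "E \<subseteq> carrier (Gam X)" "F = \<phi> ` E"
        using F(2) by (meson subset_image_iff)
      have injE: "inj_on \<phi> E" using inj E(1) inj_on_subset by blast
      then have "finite E" using F(1) E(2) finite_imageD by blast
      moreover have "sum (w \<circ> \<phi>) E = 0"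
        using 0 E(2) injE by (simp add: sum.reindex)
      moreover have "\<forall>s\<in>E. (w \<circ> \<phi>) s \<in> Piece X s b b'"
        using F(3) E by (auto simp: Piece_transport subset_iff)
      ultimately have "\<forall>s\<in>E. (w \<circ> \<phi>) s = 0"
        using D0 E(1) unfolding direct_sum_decomposition_def by blast
      then show ?thesis using E(2) by auto
    qed
    show ?thesis
      unfolding direct_sum_decomposition_def
    proof (intro conjI allI impI)
      show "\<forall>s\<in>\<phi> ` carrier (Gam X). module.subspace (Scale C) (Piece (transport \<phi> X) s b b')"
        "module.span (Scale C) (\<Union>s\<in>\<phi> ` carrier (Gam X). Piece (transport \<phi> X) s b b') = Hom C b b'"
        using D0 by (simp_all add: direct_sum_decomposition_def Piece_transport)
    qed (use ind in blast)
  qed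
  show ?thesis
    unfolding is_grading_def carrier_transport
    using X D group_transport
    by (auto simp: is_grading_def Piece_transport mult_transport group.is_monoid monoid.m_closed)
qed

lemma degree_transport:
  assumes "b \<in> Obj C" "b' \<in> Obj C" "homogeneous X b b' f"
  shows "degree X b b' f \<in> carrier (Gam X)"
    and "degree (transport \<phi> X) b b' f = \<phi> (degree X b b' f)"
proof -
  obtain s where s: "s \<in> carrier (Gam X)" "f \<in> Piece X s b b'" "f \<noteq> 0"
    using assms(3) by (auto simp: homogeneous_def)
  have "degree X b b' f = s"
    using degree_eq[OF C X assms(1,2)] s by blast
  moreover have "degree (transport \<phi> X) b b' f = \<phi> s"
    using degree_eq[OF C is_grading_transport assms(1,2)] s
    by (simp add: carrier_transport Piece_transport)
  ultimately show "degree X b b' f \<in> carrier (Gam X)"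
    "degree (transport \<phi> X) b b' f = \<phi> (degree X b b' f)"
    using s by auto
qed

lemma walk_degree_transport:
  assumes "w \<in> HW C X b b'"
  shows "walk_degree X w \<in> carrier (Gam X) \<and>
    walk_degree (transport \<phi> X) w = \<phi> (walk_degree X w)"
proof -
  interpret group "Gam X" by (fact group_Gam)
  have hom: "\<phi> \<in> hom (Gam X) (Gam (transport \<phi> X))"
    using iso_transport by (simp add: iso_def)
  have *: "degree X (dom_of v) (cod_of v) (mor v) \<in> carrier (Gam X) \<and>
      degree (transport \<phi> X) (dom_of v) (cod_of v) (mor v)
        = \<phi> (degree X (dom_of v) (cod_of v) (mor v))"
    if "virtual_morphism C v" "homogeneous X (dom_of v) (cod_of v) (mor v)" for v
    using that degree_transport by (auto simp: virtual_morphism_def)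
  have "\<forall>v\<in>set w. virtual_morphism C v \<and> homogeneous X (dom_of v) (cod_of v) (mor v)"
    using assms by (auto simp: HW_def walk_virtual_morphism)
  then show ?thesis
  proof (induction w)
    case Nil
    then show ?case by (simp add: transport_def Let_def)
  next
    case (Cons v w)
    let ?d = "degree X (dom_of v) (cod_of v) (mor v)"
    have d: "?d \<in> carrier (Gam X)"
      "degree (transport \<phi> X) (dom_of v) (cod_of v) (mor v) = \<phi> ?d"
      using * Cons.prems by auto
    have "\<phi> ?d [^]\<^bsub>Gam (transport \<phi> X)\<^esub> sign v = \<phi> (?d [^]\<^bsub>Gam X\<^esub> sign v)"
      using hom_int_pow[OF hom d(1) group_Gam group_transport] by simp
    then show ?case
      using Cons d by (simp add: mult_transport)
  qed
qed

lemma connected_transport: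
  assumes "connected_grading C X"
  shows "connected_grading C (transport \<phi> X)"
proof -
  have "walk_degree (transport \<phi> X) ` HW C X b b' = \<phi> ` walk_degree X ` HW C X b b'" for b b'
    using walk_degree_transport by (force simp: image_image)
  then show ?thesis
    using assms
    by (simp add: connected_grading_def is_grading_transport HW_transport carrier_transport)
qed

lemma homogeneous_automorphism_transport:
  "homogeneous_automorphism C U (transport \<phi> X) J = homogeneous_automorphism C U X J"
  by (simp add: homogeneous_automorphism_def homogeneous_transport)

lemma grading_morphism_transport:
  assumes U: "connected_grading C U" and b0: "b0 \<in> Obj C"
    and \<mu>: "\<mu> \<in> carrier (Gam U) \<rightarrow> carrier (Gam X)" "\<mu> \<in> extensional (carrier (Gam U))"
  shows "grading_morphism C b0 U (transport \<phi> X) (compose (carrier (Gam U)) \<phi> \<mu>)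
    \<longleftrightarrow> grading_morphism C b0 U X \<mu>"
proof -
  interpret G: group "Gam U" using U by (simp add: connected_grading_def is_grading_def)
  interpret H: group "Gam X" by (fact group_Gam)
  have "compose (carrier (Gam U)) \<phi> \<mu> \<in> hom (Gam U) (Gam (transport \<phi> X))
      \<longleftrightarrow> \<mu> \<in> hom (Gam U) (Gam X)"
  proof -
    have m: "\<mu> s \<in> carrier (Gam X)" if "s \<in> carrier (Gam U)" for s
      using \<mu>(1) that by blast
    have "\<phi> (\<mu> (s \<otimes>\<^bsub>Gam U\<^esub> t)) = \<phi> (\<mu> s) \<otimes>\<^bsub>Gam (transport \<phi> X)\<^esub> \<phi> (\<mu> t)
        \<longleftrightarrow> \<mu> (s \<otimes>\<^bsub>Gam U\<^esub> t) = \<mu> s \<otimes>\<^bsub>Gam X\<^esub> \<mu> t"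
      if "s \<in> carrier (Gam U)" "t \<in> carrier (Gam U)" for s t
      using that m inj by (simp add: mult_transport inj_on_eq_iff)
    then show ?thesis
      using m by (auto simp: hom_def compose_def carrier_transport)
  qed
  moreover have "compose (carrier (Gam U)) \<phi> \<mu> (walk_degree U w)
        = walk_degree (transport \<phi> X) (HW_map J w)
      \<longleftrightarrow> \<mu> (walk_degree U w) = walk_degree X (HW_map J w)"
    if J: "homogeneous_automorphism C U X J" and w: "w \<in> HW C U b0 b0" for J w
  proof -
    have "walk_degree U w \<in> carrier (Gam U)"
      using U b0 w by (auto simp: connected_grading_def)
    moreover have "HW_map J w \<in> HW C X b0 b0"
      using HW_map_closed[OF J w] .
    ultimately show ?thesis
      using walk_degree_transport \<mu>(1) inj by (auto simp: compose_def inj_on_eq_iff Pi_iff)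
  qed
  ultimately show ?thesis
    using \<mu>(2) compose_extensional[of "carrier (Gam U)" \<phi> \<mu>]
    unfolding grading_morphism_def homogeneous_automorphism_transport
    by (metis (no_types, lifting))
qed

end

theorem universal_grading_any_type:
  fixes C :: "('o, 'k::field, 'm::ab_group_add) kcat" and X :: "('o, 'm, 'h) grading"
  assumes C: "k_category C" and b0: "b0 \<in> Obj C"
    and U: "universal_grading C b0 U" and X: "connected_grading C X"
  shows "\<exists>!\<mu>. grading_morphism C b0 U X \<mu>"
proof -
  have gX: "is_grading C X" using X by (simp add: connected_grading_def)
  have cU: "connected_grading C U" using U by (simp add: universal_grading_def)
  define \<phi> where "\<phi> = inv_into (HW C X b0 b0) (walk_degree X)"
  have inj: "inj_on \<phi> (carrier (Gam X))"
  proof -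
    have "walk_degree X ` HW C X b0 b0 = carrier (Gam X)"
      using X b0 by (simp add: connected_grading_def)
    then show ?thesis unfolding \<phi>_def by (metis inj_on_inv_into subset_refl)
  qed
  let ?A = "carrier (Gam U)" and ?X = "transport \<phi> X"
  note iff = grading_morphism_transport[OF C gX inj cU b0]
  have ex1: "\<exists>!\<nu>. grading_morphism C b0 U ?X \<nu>"
    using U connected_transport[OF C gX inj X] by (simp add: universal_grading_def)
  then obtain \<nu> where \<nu>: "grading_morphism C b0 U ?X \<nu>" by blast
  have img: "\<nu> s \<in> \<phi> ` carrier (Gam X)" if "s \<in> ?A" for s
    using \<nu> that by (auto simp: grading_morphism_def hom_def carrier_transport[OF C gX inj])
  define \<mu> where "\<mu> = compose ?A (inv_into (carrier (Gam X)) \<phi>) \<nu>"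
  have \<mu>: "\<mu> \<in> ?A \<rightarrow> carrier (Gam X)" "\<mu> \<in> extensional ?A"
    using img by (auto simp: \<mu>_def compose_def intro: inv_into_into)
  have "compose ?A \<phi> \<mu> = \<nu>"
  proof (rule extensionalityI[of _ ?A])
    show "\<nu> \<in> extensional ?A" using \<nu> by (simp add: grading_morphism_def)
  qed (use img in \<open>auto simp: \<mu>_def compose_def f_inv_into_f\<close>)
  then have ex: "grading_morphism C b0 U X \<mu>" using iff[OF \<mu>] \<nu> by simp
  have "\<mu>1 = \<mu>2" if 1: "grading_morphism C b0 U X \<mu>1" and 2: "grading_morphism C b0 U X \<mu>2" for \<mu>1 \<mu>2
  proof (rule extensionalityI[of _ ?A])
    have P: "\<mu>1 \<in> ?A \<rightarrow> carrier (Gam X)" "\<mu>2 \<in> ?A \<rightarrow> carrier (Gam X)"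
      and E: "\<mu>1 \<in> extensional ?A" "\<mu>2 \<in> extensional ?A"
      using 1 2 by (auto simp: grading_morphism_def hom_def)
    show "\<mu>1 \<in> extensional ?A" "\<mu>2 \<in> extensional ?A" by (fact E)+
    have "compose ?A \<phi> \<mu>1 = compose ?A \<phi> \<mu>2"
      using ex1 iff[OF P(1) E(1)] iff[OF P(2) E(2)] 1 2 by blast
    then show "\<mu>1 s = \<mu>2 s" if "s \<in> ?A" for s
      using that P inj by (metis PiE compose_eq inj_onD)
  qed
  then show ?thesis using ex by blast
qed


section \<open>The Kronecker category exists\<close>

text \<open>The type \<open>bool\<close> provides the two objects, \<open>False\<close> for \<open>x\<close> and \<open>True\<close> for \<open>y\<close>.\<close>

definition kronecker :: "(bool, 'k::field, 'k \<times> 'k) kcat" where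
  "kronecker =
     \<lparr>Obj = UNIV,
      Hom = (\<lambda>b b'. if b = b' then UNIV \<times> {0} else if b' then UNIV else {0}),
      Scale = (\<lambda>c (p, q). (c * p, c * q)),
      Comp = (\<lambda>b b' b'' (p, q) (r, s). if b = b' then (r * p, r * q) else (p * r, p * s)),
      Ident = (\<lambda>b. (1, 0))\<rparr>"

lemma kronecker_category_kronecker:
  "kronecker_category (kronecker :: (bool, 'k::field, 'k \<times> 'k) kcat) False True"
proof -
  interpret V: vector_space "Scale (kronecker :: (bool, 'k, 'k \<times> 'k) kcat)"
    by unfold_locales (auto simp: kronecker_def zero_prod_def algebra_simps)
  have "V.dim (UNIV :: ('k \<times> 'k) set) = 2"
  proof -
    let ?B = "{(1, 0), (0, 1)} :: ('k \<times> 'k) set"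
    have "(1, 0) \<notin> V.span {(0, 1)}"
      unfolding V.span_singleton by (auto simp: kronecker_def)
    moreover have "V.independent {(0, 1)}"
      unfolding V.dependent_single by (simp add: zero_prod_def)
    ultimately have "V.independent ?B"
      by (simp add: V.independent_insert)
    moreover have "v \<in> V.span ?B" for v
    proof -
      have "Scale kronecker (fst v) (1, 0) + Scale kronecker (snd v) (0, 1) \<in> V.span ?B"
        by (intro V.span_add V.span_scale V.span_base) auto
      then show ?thesis by (simp add: kronecker_def)
    qed
    then have "UNIV = V.span ?B" by auto
    ultimately have "V.dim (UNIV :: ('k \<times> 'k) set) = card ?B"
      by (metis V.dim_span_eq_card_independent)
    then show ?thesis by simp
  qed
  moreover have "bij_betw (\<lambda>c::'k. (c, 0::'k)) UNIV (UNIV \<times> {0})"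
    by (auto simp: bij_betw_def inj_on_def)
  ultimately have main: "V.dim (UNIV :: ('k \<times> 'k) set) = 2"
    "bij_betw (\<lambda>c::'k. (c, 0::'k)) UNIV (UNIV \<times> {0})"
    by auto
  have sub: "V.subspace (Hom kronecker b b')" for b b' :: bool
    unfolding V.subspace_def by (auto simp: kronecker_def zero_prod_def)
  show ?thesis
  proof (unfold_locales, goal_cases)
    case (1 b b')
    show ?case by (rule sub)
  qed (use main in \<open>auto simp: kronecker_def zero_prod_def algebra_simps split: if_splits\<close>)
qed

end

theory Submission
  imports Defs "HOL-Algebra.Elementary_Groups"
begin

text \<open>
  The obstruction is a symmetry. Choose a basis \<open>e, f\<close> of the space of morphisms from \<open>x\<close> to \<open>y\<close>
  and grade the category by the group of order three, with \<open>e\<close> in degree 1 and \<open>f\<close> in degree 2. The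
  two degrees are inverse to each other and their quotient generates the group, so the grading is
  connected (\<open>connected_Z3\<close>), and the automorphism exchanging \<open>e\<close> and \<open>f\<close> inverts every degree
  (\<open>exists_degree_inverting\<close>).

  Let \<open>U\<close> be universal and \<open>\<mu>\<close> the morphism from \<open>U\<close> to this grading, realised by an automorphism
  \<open>J\<close>. Composing \<open>J\<close> with the exchange realises the pointwise inverse of \<open>\<mu>\<close>, which is again a group
  map because the target is commutative (\<open>grading_morphism_inverse\<close>). Uniqueness forces \<open>\<mu>\<close> to equal
  its inverse, hence to be trivial, as the group has no element of order two. Going from \<open>x\<close> to \<open>y\<close>
  along one \<open>U\<close>-homogeneous morphism and back along another is a walk from \<open>x\<close> to \<open>x\<close>, so the images
  of all \<open>U\<close>-homogeneous morphisms under \<open>J\<close> have one common degree. These morphisms span the whole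
  two-dimensional space, but each component of the target between \<open>x\<close> and \<open>y\<close> is at most a line,
  which contradicts the surjectivity of \<open>J\<close>.
\<close>


section \<open>Homogeneous walks and automorphisms\<close>

lemma HW_single:
  assumes "virtual_morphism C v" "homogeneous X (dom_of v) (cod_of v) (mor v)"
    "b = vsource v" "b' = vtarget v"
  shows "[v] \<in> HW C X b b'"
  using assms walk.single by (auto simp: HW_def)

lemma HW_Cons:
  assumes "u # w \<in> HW C X b (vsource v)" "virtual_morphism C v"
    "homogeneous X (dom_of v) (cod_of v) (mor v)" "b' = vtarget v"
  shows "v # u # w \<in> HW C X b b'"
  using assms walk.step by (auto simp: HW_def)

lemma HW_map_comp: "HW_map (\<lambda>b b' f. S b b' (J b b' f)) w = HW_map S (HW_map J w)"
  by (simp add: HW_map_def)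

lemma linear_automorphismD:
  assumes "linear_automorphism C (\<lambda>b. b) J" "b \<in> Obj C" "b' \<in> Obj C"
  shows "bij_betw (J b b') (Hom C b b') (Hom C b b')"
    and "\<lbrakk>g \<in> Hom C b b'; h \<in> Hom C b b'\<rbrakk> \<Longrightarrow> J b b' (g + h) = J b b' g + J b b' h"
    and "g \<in> Hom C b b' \<Longrightarrow> J b b' (Scale C c g) = Scale C c (J b b' g)"
  using assms by (simp_all add: linear_automorphism_def)

lemma linear_automorphism_zero:
  assumes "linear_automorphism C (\<lambda>b. b) J" "b \<in> Obj C" "b' \<in> Obj C" "0 \<in> Hom C b b'"
  shows "J b b' 0 = (0 :: 'm::ab_group_add)"
  using linear_automorphismD(2)[OF assms assms(4)] by simp

lemma linear_automorphism_comp: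
  assumes J: "linear_automorphism C (\<lambda>b. b) J" and S: "linear_automorphism C (\<lambda>b. b) S"
  shows "linear_automorphism C (\<lambda>b. b) (\<lambda>b b' f. S b b' (J b b' f))"
proof -
  have "J b b' f \<in> Hom C b b'" if "b \<in> Obj C" "b' \<in> Obj C" "f \<in> Hom C b b'" for b b' f
    using linear_automorphismD(1)[OF J that(1,2)] that(3) by (rule bij_betw_apply)
  moreover have "bij_betw (\<lambda>f. S b b' (J b b' f)) (Hom C b b') (Hom C b b')"
    if "b \<in> Obj C" "b' \<in> Obj C" for b b'
    using bij_betw_trans[OF linear_automorphismD(1)[OF J that] linear_automorphismD(1)[OF S that]]
    by (simp add: comp_def)
  ultimately show ?thesis
    using J S unfolding linear_automorphism_def by simp
qed

lemma homogeneous_automorphism_comp: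
  assumes "homogeneous_automorphism C X Y J" "homogeneous_automorphism C Y Z S"
  shows "homogeneous_automorphism C X Z (\<lambda>b b' f. S b b' (J b b' f))"
  using assms linear_automorphism_comp unfolding homogeneous_automorphism_def by blast

lemma (in k_category) span_Pieces:
  assumes "is_grading C X" "b \<in> Obj C" "b' \<in> Obj C"
  shows "span (\<Union>s\<in>carrier (Gam X). Piece X s b b') = Hom C b b'"
proof -
  have "direct_sum_decomposition (Scale C) (Hom C b b') (carrier (Gam X)) (\<lambda>s. Piece X s b b')"
    using assms by (simp add: is_grading_def)
  then show ?thesis by (simp add: direct_sum_decomposition_def)
qed

lemma (in k_category) Piece_in_Hom:
  assumes "is_grading C X" "b \<in> Obj C" "b' \<in> Obj C" "s \<in> carrier (Gam X)" "h \<in> Piece X s b b'"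
  shows "h \<in> Hom C b b'"
  unfolding span_Pieces[OF assms(1-3), symmetric] using assms(4,5) by (intro span_base) blast


section \<open>Automorphisms that invert degrees\<close>

locale degree_inverting_automorphism = k_category C
  for C :: "('o, 'k::field, 'm::ab_group_add) kcat" and X :: "('o, 'm, 'g) grading"
    and S :: "'o \<Rightarrow> 'o \<Rightarrow> 'm \<Rightarrow> 'm" +
  assumes grading: "is_grading C X"
    and comm: "comm_group (Gam X)"
    and automorphism: "linear_automorphism C (\<lambda>b. b) S"
    and inverts: "\<lbrakk>b \<in> Obj C; b' \<in> Obj C; s \<in> carrier (Gam X); h \<in> Piece X s b b'\<rbrakk>
      \<Longrightarrow> S b b' h \<in> Piece X (inv\<^bsub>Gam X\<^esub> s) b b'"
begin

lemma nonzero: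
  assumes "b \<in> Obj C" "b' \<in> Obj C" "h \<in> Hom C b b'" "h \<noteq> 0"
  shows "S b b' h \<noteq> 0"
proof
  assume "S b b' h = 0"
  moreover have 0: "0 \<in> Hom C b b'" by (rule subspace_0[OF subspace_Hom[OF assms(1,2)]])
  ultimately have "S b b' h = S b b' 0"
    using linear_automorphism_zero[OF automorphism assms(1,2)] by simp
  then have "h = 0"
    by (rule inj_onD[OF bij_betw_imp_inj_on[OF linear_automorphismD(1)[OF automorphism assms(1,2)]]])
      (fact assms(3) 0)+
  then show False using assms(4) by contradiction
qed

lemma degree_inverted:
  assumes b: "b \<in> Obj C" "b' \<in> Obj C" and h: "homogeneous X b b' h"
  shows "degree X b b' h \<in> carrier (Gam X)"
    and "homogeneous X b b' (S b b' h)"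
    and "degree X b b' (S b b' h) = inv\<^bsub>Gam X\<^esub> degree X b b' h"
proof -
  interpret G: comm_group "Gam X" by (fact comm)
  obtain s where s: "s \<in> carrier (Gam X)" "h \<in> Piece X s b b'" "h \<noteq> 0"
    using h by (auto simp: homogeneous_def)
  have d: "degree X b b' h = s"
    by (rule degree_eq[OF k_category_axioms grading b s])
  have *: "S b b' h \<in> Piece X (inv\<^bsub>Gam X\<^esub> s) b b'" using inverts b s by blast
  have nz: "S b b' h \<noteq> 0" using nonzero[OF b Piece_in_Hom[OF grading b s(1,2)] s(3)] .
  show "degree X b b' h \<in> carrier (Gam X)" using d s by simp
  show "homogeneous X b b' (S b b' h)"
    using * nz s by (auto simp: homogeneous_def)
  show "degree X b b' (S b b' h) = inv\<^bsub>Gam X\<^esub> degree X b b' h"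
    using degree_eq[OF k_category_axioms grading b _ * nz] s d by simp
qed

lemma homogeneous_automorphism: "homogeneous_automorphism C X X S"
  unfolding homogeneous_automorphism_def using automorphism degree_inverted(2) by blast

text \<open>
  Inversion reverses products, so degrees of walks are inverted factor by factor only because the
  structural group is commutative.
\<close>

lemma walk_degree_inverted:
  assumes "w \<in> HW C X b b'"
  shows "walk_degree X (HW_map S w) = inv\<^bsub>Gam X\<^esub> walk_degree X w"
proof -
  interpret G: comm_group "Gam X" by (fact comm)
  have "\<forall>v\<in>set w. virtual_morphism C v \<and> homogeneous X (dom_of v) (cod_of v) (mor v)"
    using assms by (auto simp: HW_def walk_virtual_morphism)
  then have "walk_degree X w \<in> carrier (Gam X) \<and>
    walk_degree X (HW_map S w) = inv\<^bsub>Gam X\<^esub> walk_degree X w"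
  proof (induction w)
    case (Cons v w)
    then show ?case
      using degree_inverted[of "dom_of v" "cod_of v" "mor v"]
      by (auto simp: HW_map_def virtual_morphism_def G.inv_mult G.int_pow_inv)
  qed (simp add: HW_map_def)
  then show ?thesis by blast
qed

text \<open>
  The inverse is realised by following an automorphism that realises \<open>\<mu>\<close> with \<open>S\<close>. If \<open>\<mu>\<close> is the
  only morphism, it therefore takes values that are their own inverses.
\<close>

lemma grading_morphism_inverse:
  assumes U: "connected_grading C U" and b0: "b0 \<in> Obj C"
    and \<mu>: "grading_morphism C b0 U X \<mu>"
  shows "grading_morphism C b0 U X (\<lambda>s\<in>carrier (Gam U). inv\<^bsub>Gam X\<^esub> \<mu> s)"
proof -
  interpret G: comm_group "Gam X" by (fact comm)
  interpret U: group "Gam U" using U by (simp add: connected_grading_def is_grading_def)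
  obtain J where hom: "\<mu> \<in> hom (Gam U) (Gam X)" and J: "homogeneous_automorphism C U X J"
    and eq: "\<And>w. w \<in> HW C U b0 b0 \<Longrightarrow> \<mu> (walk_degree U w) = walk_degree X (HW_map J w)"
    using \<mu> by (auto simp: grading_morphism_def)
  have "(\<lambda>s\<in>carrier (Gam U). inv\<^bsub>Gam X\<^esub> \<mu> s) \<in> hom (Gam U) (Gam X)"
    using hom by (auto simp: hom_def G.inv_mult Pi_iff)
  moreover have "(\<lambda>s\<in>carrier (Gam U). inv\<^bsub>Gam X\<^esub> \<mu> s) (walk_degree U w)
      = walk_degree X (HW_map (\<lambda>b b' f. S b b' (J b b' f)) w)" if w: "w \<in> HW C U b0 b0" for w
  proof -
    have "walk_degree U w \<in> carrier (Gam U)"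
      using U b0 w by (auto simp: connected_grading_def)
    then show ?thesis
      using eq[OF w] walk_degree_inverted[OF HW_map_closed[OF J w]] by (simp add: HW_map_comp)
  qed
  ultimately show ?thesis
    unfolding grading_morphism_def
    using homogeneous_automorphism_comp[OF J homogeneous_automorphism] restrict_extensional
    by blast
qed

end


section \<open>A connected grading of the Kronecker category by the group of order three\<close>

text \<open>
  Morphism spaces split in two ways below: into two lines, or, with \<open>B = {0}\<close>, into a single component.
\<close>

lemma direct_sum_of_two:
  assumes vs: "vector_space sc" and AB: "module.subspace sc A" "module.subspace sc B"
    and int: "A \<inter> B = {0}" and s: "s1 \<in> S" "s2 \<in> S" "s1 \<noteq> s2"
  shows "direct_sum_decomposition sc (module.span sc (A \<union> B)) S
    (\<lambda>s. if s = s1 then A else if s = s2 then B else {0 :: 'm::ab_group_add})"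
proof -
  interpret vector_space sc by (fact vs)
  let ?W = "\<lambda>s. if s = s1 then A else if s = s2 then B else {0 :: 'm}"
  have U: "(\<Union>s\<in>S. ?W s) = A \<union> B"
    using s AB subspace_0 by (fastforce split: if_splits)
  have "\<forall>s\<in>F. w s = 0"
    if F: "finite F" "\<forall>s\<in>F. w s \<in> ?W s" "sum w F = 0" for F w
  proof -
    \<comment> \<open>Extension by zero, so that both relevant indices may be assumed to lie in the support.\<close>
    define a where "a s = (if s \<in> F then w s else 0)" for s
    have aA: "a s1 \<in> A" "a s2 \<in> B"
      using F(2) s AB subspace_0 by (auto simp: a_def dest: bspec)
    have z: "a s = 0" if "s \<noteq> s1" "s \<noteq> s2" for s
      using F(2) that by (auto simp: a_def)
    have "0 = sum a (F \<union> {s1, s2})"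
      using F(1,3) by (subst sum.mono_neutral_right[of _ F]) (auto simp: a_def)
    also have "\<dots> = sum a {s1, s2}"
      using F(1) z by (intro sum.mono_neutral_right) auto
    finally have sum: "a s1 + a s2 = 0" using s by simp
    then have "a s1 = - a s2" by (simp add: eq_neg_iff_add_eq_0)
    then have "a s1 \<in> B" using aA subspace_neg[OF AB(2)] by simp
    then have "a s1 = 0" using aA int by blast
    then show ?thesis using sum z by (metis a_def add_0)
  qed
  moreover have "subspace (?W s)" for s using AB by simp
  ultimately show ?thesis unfolding direct_sum_decomposition_def U by blast
qed

locale kronecker_basis = kronecker_category K x y
  for K :: "('o, 'k::field, 'm::ab_group_add) kcat" and x y :: 'o +
  fixes e f :: 'm
  assumes distinct: "e \<noteq> f" and independent: "independent {e, f}"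
    and span_basis: "span {e, f} = Hom K x y"
begin

text \<open>
  The order three lets \<open>e\<close> and \<open>f\<close> have inverse degrees although the quotient of these degrees
  generates the group. In the infinite cyclic group, inverse degrees \<open>s\<close> and \<open>-s\<close> would give closed
  walks only degrees divisible by \<open>2 s\<close>, and the grading would not be connected.
\<close>

definition Z3 :: "('o, 'm, int) grading" where
  "Z3 = \<lparr>Gam = integer_mod_group 3,
     Piece = (\<lambda>s b b'. if b = x \<and> b' = y
       then if s = 1 then span {e} else if s = 2 then span {f} else {0}
       else if s = 0 then Hom K b b' else {0})\<rparr>"

lemma Gam_Z3: "Gam Z3 = integer_mod_group 3"
  by (simp add: Z3_def)

lemma carrier_Z3: "carrier (Gam Z3) = {0, 1, 2}"
  by (auto simp: Z3_def carrier_integer_mod_group)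

lemma span_lines_inter: "span {e} \<inter> span {f} = {0}"
proof -
  have "v = 0" if v: "v \<in> span {e}" "v \<in> span {f}" for v
  proof (rule ccontr)
    assume "v \<noteq> 0"
    obtain c where c: "v = Scale K c e"
      using v(1) unfolding span_singleton by blast
    with \<open>v \<noteq> 0\<close> have "c \<noteq> 0" by auto
    then have "e = Scale K (inverse c) v" using c by simp
    then have "e \<in> span {f}" using v(2) span_scale by metis
    then show False using independent distinct by (simp add: independent_insert)
  qed
  then show ?thesis by (auto simp: span_zero)
qed

lemma basis_nonzero: "e \<noteq> 0" "f \<noteq> 0"
  using independent dependent_zero by blast+

lemma basis_in_Hom: "e \<in> Hom K x y" "f \<in> Hom K x y"
  using span_basis span_base by blast+

lemma zero_in_Hom: "b \<in> Obj K \<Longrightarrow> b' \<in> Obj K \<Longrightarrow> 0 \<in> Hom K b b'"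
  by (simp add: subspace_Hom subspace_0)

lemma subspace_Piece: "b \<in> Obj K \<Longrightarrow> b' \<in> Obj K \<Longrightarrow> subspace (Piece Z3 s b b')"
  by (simp add: Z3_def subspace_Hom)

lemma Piece_Z3_subset: "b \<in> Obj K \<Longrightarrow> b' \<in> Obj K \<Longrightarrow> Piece Z3 s b b' \<subseteq> Hom K b b'"
  using span_mono[of "{e}" "{e, f}"] span_mono[of "{f}" "{e, f}"]
  by (auto simp: Z3_def zero_in_Hom span_basis)

lemma Comp_scalar_right:
  assumes "b \<in> Obj K" "b' \<in> Obj K" "h \<in> Hom K b b'"
  shows "Comp K b b b' h (Scale K c (Ident K b)) = Scale K c h"
  using assms by (simp add: Comp_scale_right Ident_closed Ident_right)

lemma Comp_scalar_left:
  assumes "b \<in> Obj K" "b' \<in> Obj K" "g \<in> Hom K b b'"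
  shows "Comp K b b' b' (Scale K c (Ident K b')) g = Scale K c g"
  using assms by (simp add: Comp_scale_left Ident_closed Ident_left)

lemma Comp_zero:
  assumes "b \<in> Obj K" "b' \<in> Obj K" "b'' \<in> Obj K" "g \<in> Hom K b b'" "h \<in> Hom K b' b''"
  shows "g = 0 \<or> h = 0 \<Longrightarrow> Comp K b b' b'' h g = 0"
  using Comp_scale_left[OF assms, of 0] Comp_scale_right[OF assms, of 0] by auto

lemma endomorphism_scalar:
  assumes "b \<in> Obj K" "h \<in> Hom K b b"
  obtains c where "h = Scale K c (Ident K b)"
proof -
  have "h \<in> range (\<lambda>c. Scale K c (Ident K b))"
    using assms objects(1) bij_betw_imp_surj_on[OF End_x] bij_betw_imp_surj_on[OF End_y] by auto
  then show thesis using that by blast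
qed

text \<open>
  Composition in the Kronecker category is only scalar multiplication: this reduces compatibility
  with composition, for gradings and for automorphisms, to linearity.
\<close>

lemma composable_cases:
  assumes "b \<in> Obj K" "b' \<in> Obj K" "b'' \<in> Obj K" "g \<in> Hom K b b'" "h \<in> Hom K b' b''"
  obtains (right_scalar) c where "b' = b" "g = Scale K c (Ident K b)"
  | (left_scalar) c where "b'' = b'" "h = Scale K c (Ident K b')"
  | (zero) "b'' = b" "g = 0 \<or> h = 0"
proof -
  consider "b' = b" | "b'' = b'" | "b' \<noteq> b" "b'' \<noteq> b'" by blast
  then show thesis
  proof cases
    case 1
    then have "g \<in> Hom K b b" using assms by simp
    with assms(1) obtain c where "g = Scale K c (Ident K b)" by (rule endomorphism_scalar)
    then show thesis using 1 right_scalar by blast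
  next
    case 2
    then have "h \<in> Hom K b' b'" using assms by simp
    with assms(2) obtain c where "h = Scale K c (Ident K b')" by (rule endomorphism_scalar)
    then show thesis using 2 left_scalar by blast
  next
    case 3
    \<comment> \<open>With only two objects, one of the factors runs from \<open>y\<close> to \<open>x\<close>.\<close>
    then show thesis using zero assms objects Hom_y_x by auto
  qed
qed

lemma decomposition_Z3:
  assumes b: "b \<in> Obj K" "b' \<in> Obj K"
  shows "direct_sum_decomposition (Scale K) (Hom K b b') (carrier (Gam Z3)) (\<lambda>s. Piece Z3 s b b')"
proof (cases "b = x \<and> b' = y")
  case True
  have "span (span {e} \<union> span {f}) = span ({e} \<union> {f})"
    unfolding span_Un span_span ..
  then have span: "span (span {e} \<union> span {f}) = Hom K b b'"
    using span_basis True by (simp add: insert_commute)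
  have Piece: "(\<lambda>s. Piece Z3 s b b')
      = (\<lambda>s. if s = 1 then span {e} else if s = 2 then span {f} else {0})"
    using True by (simp add: Z3_def)
  show ?thesis
    unfolding Piece carrier_Z3 span[symmetric]
    by (rule direct_sum_of_two[OF vector_space_axioms _ _ span_lines_inter]) auto
next
  case False
  have Piece: "(\<lambda>s. Piece Z3 s b b') = (\<lambda>s. if s = 0 then Hom K b b' else if s = 1 then {0} else {0})"
    using False by (intro ext) (auto simp: Z3_def)
  have zero: "Hom K b b' \<union> {0} = Hom K b b'" "Hom K b b' \<inter> {0} = {0}"
    using zero_in_Hom[OF b] by auto
  have span: "span (Hom K b b' \<union> {0}) = Hom K b b'"
    unfolding zero using subspace_Hom[OF b] by simp
  have "direct_sum_decomposition (Scale K) (span (Hom K b b' \<union> {0})) {0, 1, 2 :: int}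
      (\<lambda>s. if s = 0 then Hom K b b' else if s = 1 then {0} else {0})"
    by (rule direct_sum_of_two[OF vector_space_axioms subspace_Hom[OF b] _ zero(2)]) auto
  then show ?thesis
    unfolding Piece carrier_Z3 span .
qed

lemma Comp_Piece_Z3:
  assumes b: "b \<in> Obj K" "b' \<in> Obj K" "b'' \<in> Obj K"
    and s: "s \<in> carrier (Gam Z3)" "t \<in> carrier (Gam Z3)"
    and g: "g \<in> Piece Z3 s b b'" and h: "h \<in> Piece Z3 t b' b''"
  shows "Comp K b b' b'' h g \<in> Piece Z3 (t \<otimes>\<^bsub>Gam Z3\<^esub> s) b b''"
proof -
  have Hom: "g \<in> Hom K b b'" "h \<in> Hom K b' b''"
    using g h Piece_Z3_subset[OF b(1,2)] Piece_Z3_subset[OF b(2,3)] by auto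
  have unit: "t \<otimes>\<^bsub>Gam Z3\<^esub> 0 = t" "0 \<otimes>\<^bsub>Gam Z3\<^esub> s = s"
    using s unfolding carrier_Z3 by (auto simp: Gam_Z3)
  \<comment> \<open>A nonzero endomorphism has degree 0.\<close>
  have endo: "u = 0 \<or> r = 0" if "u \<in> Piece Z3 r a a" for u r a
    using that objects(2) by (auto simp: Z3_def split: if_splits)
  show ?thesis
  proof (cases "g = 0 \<or> h = 0")
    case True
    then show ?thesis
      using Comp_zero[OF b Hom] subspace_0[OF subspace_Piece[OF b(1,3)]] by simp
  next
    case False
    from b Hom show ?thesis
    proof (cases rule: composable_cases)
      case (right_scalar c)
      then have "Comp K b b' b'' h g = Scale K c h"
        using Comp_scalar_right[OF b(1,3)] Hom by simp
      moreover have "s = 0" using endo[of g s b] g right_scalar False by simp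
      ultimately show ?thesis
        using unit subspace_scale[OF subspace_Piece[OF b(2,3)] h] right_scalar(1) by simp
    next
      case (left_scalar c)
      then have "Comp K b b' b'' h g = Scale K c g"
        using Comp_scalar_left[OF b(1,2)] Hom by simp
      moreover have "t = 0" using endo[of h t b'] h left_scalar False by simp
      ultimately show ?thesis
        using unit subspace_scale[OF subspace_Piece[OF b(1,2)] g] left_scalar(1) by simp
    qed (use False in blast)
  qed
qed

lemma is_grading_Z3: "is_grading K Z3"
proof -
  have "group (Gam Z3)" by (simp add: Gam_Z3)
  then show ?thesis
    unfolding is_grading_def using decomposition_Z3 Comp_Piece_Z3 by blast
qed

lemma Ident_nonzero: "b \<in> Obj K \<Longrightarrow> Ident K b \<noteq> 0"
proof
  assume "b \<in> Obj K" "Ident K b = 0"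
  then have "inj (\<lambda>c :: 'k. 0 :: 'm)"
    using End_x End_y objects by (auto simp: bij_betw_def)
  then show False using zero_neq_one by (metis injD)
qed

lemma homogeneous_Z3:
  shows "homogeneous Z3 x y e" "degree Z3 x y e = 1"
    and "homogeneous Z3 x y f" "degree Z3 x y f = 2"
    and "b \<in> Obj K \<Longrightarrow> homogeneous Z3 b b (Ident K b)"
    and "b \<in> Obj K \<Longrightarrow> degree Z3 b b (Ident K b) = 0"
proof -
  have k: "k_category K" by unfold_locales
  have P: "e \<in> Piece Z3 1 x y" "f \<in> Piece Z3 2 x y"
    using span_base by (auto simp: Z3_def)
  have I: "Ident K b \<in> Piece Z3 0 b b" if "b \<in> Obj K" for b
    using that objects(2) Ident_closed by (auto simp: Z3_def)
  show "homogeneous Z3 x y e" "homogeneous Z3 x y f"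
    using P basis_nonzero carrier_Z3 by (auto simp: homogeneous_def)
  show "degree Z3 x y e = 1" "degree Z3 x y f = 2"
    using degree_eq[OF k is_grading_Z3] P basis_nonzero objects carrier_Z3 by auto
  show "homogeneous Z3 b b (Ident K b)" if "b \<in> Obj K"
    using I that Ident_nonzero carrier_Z3 by (auto simp: homogeneous_def)
  show "degree Z3 b b (Ident K b) = 0" if "b \<in> Obj K"
    using degree_eq[OF k is_grading_Z3 that that _ I[OF that]] Ident_nonzero[OF that] carrier_Z3
    by auto
qed

text \<open>
  Closed walks that traverse one of \<open>e, f\<close> forwards and the other backwards have the two nonzero
  degrees \<open>2 - 1\<close> and \<open>1 - 2\<close>. Between distinct objects, single arrows have the two nonzero degrees,
  and degree 0 takes three steps.
\<close>

lemma connected_Z3: "connected_grading K Z3"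
proof -
  define E F where "E = VMor x y e" and "F = VMor x y f"
  define I where "I b = VMor b b (Ident K b) 1" for b
  have vm: "virtual_morphism K (E 1)" "virtual_morphism K (E (-1))"
    "virtual_morphism K (F 1)" "virtual_morphism K (F (-1))"
    "virtual_morphism K (I x)" "virtual_morphism K (I y)"
    using objects basis_in_Hom basis_nonzero Ident_closed Ident_nonzero
    by (auto simp: virtual_morphism_def E_def F_def I_def)
  have ends [simp]: "vsource (E s) = (if s = 1 then x else y)" "vtarget (E s) = (if s = 1 then y else x)"
    "vsource (F s) = (if s = 1 then x else y)" "vtarget (F s) = (if s = 1 then y else x)"
    "vsource (I b) = b" "vtarget (I b) = b" for s b
    by (simp_all add: vsource_def vtarget_def E_def F_def I_def)
  have hom: "homogeneous Z3 (dom_of (E s)) (cod_of (E s)) (mor (E s))"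
    "homogeneous Z3 (dom_of (F s)) (cod_of (F s)) (mor (F s))"
    "homogeneous Z3 (dom_of (I x)) (cod_of (I x)) (mor (I x))"
    "homogeneous Z3 (dom_of (I y)) (cod_of (I y)) (mor (I y))" for s
    using homogeneous_Z3(1,3,5) objects(1) by (simp_all add: E_def F_def I_def)
  have deg: "walk_degree Z3 (E s # w) = (s + walk_degree Z3 w) mod 3"
    "walk_degree Z3 (F s # w) = (2 * s + walk_degree Z3 w) mod 3"
    "walk_degree Z3 (I x # w) = walk_degree Z3 w mod 3"
    "walk_degree Z3 (I y # w) = walk_degree Z3 w mod 3"
    "walk_degree Z3 [] = 0" for s w
    using homogeneous_Z3 objects unfolding E_def F_def I_def
    by (simp_all add: Gam_Z3 int_pow_integer_mod_group mod_add_left_eq mult.commute)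
  note walk = HW_single HW_Cons vm hom
  have all: "{0, 1, 2} \<subseteq> walk_degree Z3 ` A"
    if "u \<in> A" "v \<in> A" "w \<in> A"
      and "walk_degree Z3 u = 0" "walk_degree Z3 v = 1" "walk_degree Z3 w = 2" for u v w A
    using that by (metis empty_subsetI imageI insert_subset)
  have "{0, 1, 2} \<subseteq> walk_degree Z3 ` HW K Z3 x x"
    by (rule all[of "[I x]" _ "[E (-1), F 1]" "[F (-1), E 1]"])
      (auto intro!: walk simp: deg simp del: walk_degree.simps)
  moreover have "{0, 1, 2} \<subseteq> walk_degree Z3 ` HW K Z3 y y"
    by (rule all[of "[I y]" _ "[F 1, E (-1)]" "[E 1, F (-1)]"])
      (auto intro!: walk simp: deg simp del: walk_degree.simps)
  moreover have "{0, 1, 2} \<subseteq> walk_degree Z3 ` HW K Z3 x y"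
    by (rule all[of "[E 1, F (-1), E 1]" _ "[E 1]" "[F 1]"])
      (auto intro!: walk simp: deg simp del: walk_degree.simps)
  moreover have "{0, 1, 2} \<subseteq> walk_degree Z3 ` HW K Z3 y x"
    by (rule all[of "[E (-1), F 1, E (-1)]" _ "[F (-1)]" "[E (-1)]"])
      (auto intro!: walk simp: deg simp del: walk_degree.simps)
  ultimately have "{0, 1, 2} \<subseteq> walk_degree Z3 ` HW K Z3 b b'"
    if "b \<in> Obj K" "b' \<in> Obj K" for b b'
    using that unfolding objects(1) by blast
  moreover have "walk_degree Z3 w \<in> carrier (Gam Z3)" for w :: "('o, 'm) vmor list"
    by (cases w) (auto simp: Gam_Z3 carrier_integer_mod_group)
  ultimately show ?thesis
    unfolding connected_grading_def using is_grading_Z3 carrier_Z3 by fastforce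
qed

text \<open>
  Exchanging \<open>e\<close> and \<open>f\<close> exchanges the degrees 1 and 2, which are inverse modulo 3; every other
  homogeneous morphism is an endomorphism of degree 0.
\<close>

lemma exists_degree_inverting:
  obtains S where "degree_inverting_automorphism K Z3 S"
proof -
  interpret P: vector_space_pair "Scale K" "Scale K" ..
  obtain g where lin: "Vector_Spaces.linear (Scale K) (Scale K) g" and ge: "g e = f" "g f = e"
    using P.linear_independent_extend[OF independent, of "\<lambda>v. if v = e then f else e"] distinct
    by auto
  interpret g: linear "Scale K" "Scale K" g by (fact lin)
  have gH: "g v \<in> Hom K x y" if "v \<in> Hom K x y" for v
    using that ge g.span_image[of "{e, f}"] by (auto simp: span_basis[symmetric] insert_commute)
  have gg: "g (g v) = v" if "v \<in> Hom K x y" for v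
  proof (rule P.linear_eq_on[where B = "{e, f}"])
    show "Vector_Spaces.linear (Scale K) (Scale K) (\<lambda>v. g (g v))"
      using Vector_Spaces.linear_compose[OF lin lin] by (simp add: comp_def)
    show "Vector_Spaces.linear (Scale K) (Scale K) (\<lambda>v. v)"
      using linear_id by (simp add: id_def)
  qed (use that ge span_basis in auto)
  define S where "S b b' = (if b = x \<and> b' = y then g else (\<lambda>v. v))" for b b'
  have bij: "bij_betw (S b b') (Hom K b b') (Hom K b b')" for b b'
  proof (cases "b = x \<and> b' = y")
    case True
    then show ?thesis
      unfolding S_def using gH gg by (auto intro!: bij_betwI[where g = g])
  qed (auto simp: S_def bij_betw_def inj_on_def)
  have endo: "S b b h = h" for b h
    using objects(2) by (auto simp: S_def)
  have closed: "S b b' h \<in> Hom K b b'" if "h \<in> Hom K b b'" for b b' h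
    using bij that by (auto simp: bij_betw_def)
  have scale: "S b b' (Scale K c h) = Scale K c (S b b' h)" for b b' c h
    by (simp add: S_def g.scale)
  have zero: "S b b' 0 = 0" for b b'
    by (simp add: S_def g.zero)
  have comp: "S b b'' (Comp K b b' b'' h k) = Comp K b b' b'' (S b' b'' h) (S b b' k)"
    if b: "b \<in> Obj K" "b' \<in> Obj K" "b'' \<in> Obj K" and hk: "k \<in> Hom K b b'" "h \<in> Hom K b' b''"
    for b b' b'' h k
    using b hk
  proof (cases rule: composable_cases)
    case (right_scalar c)
    then show ?thesis using b hk closed by (simp add: Comp_scalar_right endo scale)
  next
    case (left_scalar c)
    then show ?thesis using b hk closed by (simp add: Comp_scalar_left endo scale)
  next
    case z: zero
    then have "S b b' k = 0 \<or> S b' b'' h = 0" using zero by auto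
    then show ?thesis using z(2) Comp_zero[OF b hk] Comp_zero[OF b] closed hk zero by simp
  qed
  have add: "S b b' (h + k) = S b b' h + S b b' k" for b b' h k
    by (simp add: S_def g.add)
  have "bij_betw (\<lambda>b. b) (Obj K) (Obj K)" by (simp add: bij_betw_def inj_on_def)
  then have "linear_automorphism K (\<lambda>b. b) S"
    unfolding linear_automorphism_def using bij comp by (simp add: endo scale add)
  moreover have "S b b' h \<in> Piece Z3 (inv\<^bsub>Gam Z3\<^esub> s) b b'"
    if b: "b \<in> Obj K" "b' \<in> Obj K" and s: "s \<in> carrier (Gam Z3)" and h: "h \<in> Piece Z3 s b b'"
    for b b' s h
  proof -
    have "v \<in> span {e} \<Longrightarrow> g v \<in> span {f}" "v \<in> span {f} \<Longrightarrow> g v \<in> span {e}" for v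
      using g.span_image[of "{e}"] g.span_image[of "{f}"] ge by auto
    moreover have "inv\<^bsub>Gam Z3\<^esub> s = (- s) mod 3"
      using s by (simp add: Gam_Z3)
    ultimately show ?thesis
      using s h unfolding carrier_Z3 by (auto simp: Z3_def S_def g.zero split: if_splits)
  qed
  moreover have "comm_group (Gam Z3)" by (simp add: Gam_Z3)
  ultimately have "degree_inverting_automorphism K Z3 S"
    using is_grading_Z3 k_category_axioms
    by (intro degree_inverting_automorphism.intro degree_inverting_automorphism_axioms.intro)
  then show thesis using that by blast
qed


section \<open>Failure of universality\<close>

theorem no_universal_grading: "\<not> universal_grading K x (U :: ('o, 'm, 'g) grading)"
proof
  assume U: "universal_grading K x U"
  have k: "k_category K" by unfold_locales
  have xy: "x \<in> Obj K" "y \<in> Obj K" using objects by auto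
  have cU: "connected_grading K U" and gU: "is_grading K U"
    using U by (auto simp: universal_grading_def connected_grading_def)
  obtain S where "degree_inverting_automorphism K Z3 S" by (rule exists_degree_inverting)
  then interpret S: degree_inverting_automorphism K Z3 S .
  have ex1: "\<exists>!\<mu>. grading_morphism K x U Z3 \<mu>"
    by (rule universal_grading_any_type[OF k xy(1) U connected_Z3])
  then obtain \<mu> where \<mu>: "grading_morphism K x U Z3 \<mu>" by blast
  then obtain J where hom: "\<mu> \<in> hom (Gam U) (Gam Z3)" and J: "homogeneous_automorphism K U Z3 J"
    and eq: "\<And>w. w \<in> HW K U x x \<Longrightarrow> \<mu> (walk_degree U w) = walk_degree Z3 (HW_map J w)"
    by (auto simp: grading_morphism_def)
  \<comment> \<open>Modulo 3, only 0 equals its own negative.\<close>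
  have trivial: "\<mu> s = 0" if s: "s \<in> carrier (Gam U)" for s
  proof -
    have "(\<lambda>s\<in>carrier (Gam U). inv\<^bsub>Gam Z3\<^esub> \<mu> s) = \<mu>"
      using S.grading_morphism_inverse[OF cU xy(1) \<mu>] ex1 \<mu> by blast
    then have "inv\<^bsub>Gam Z3\<^esub> \<mu> s = \<mu> s" using s by (metis restrict_apply')
    moreover have "\<mu> s \<in> carrier (Gam Z3)" using hom s by (auto simp: hom_def)
    ultimately show ?thesis unfolding carrier_Z3
      by (auto simp: Gam_Z3 carrier_integer_mod_group)
  qed
  have JPiece: "J x y h \<in> Piece Z3 (degree Z3 x y (J x y h)) x y \<and> degree Z3 x y (J x y h) \<in> {1, 2}"
    if h: "homogeneous U x y h" for h
  proof -
    have "homogeneous Z3 x y (J x y h)"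
      using J h xy by (simp add: homogeneous_automorphism_def)
    then obtain s where s: "s \<in> carrier (Gam Z3)" "J x y h \<in> Piece Z3 s x y" "J x y h \<noteq> 0"
      by (auto simp: homogeneous_def)
    have "degree Z3 x y (J x y h) = s"
      by (rule degree_eq[OF k is_grading_Z3 xy s])
    moreover have "s \<in> {1, 2}"
      using s(2,3) by (auto simp: Z3_def split: if_splits)
    ultimately show ?thesis using s(2) by simp
  qed
  have spanU: "span (\<Union>s\<in>carrier (Gam U). Piece U s x y) = Hom K x y"
    by (rule span_Pieces[OF gU xy])
  \<comment> \<open>The degree of a closed walk is killed by \<open>\<mu>\<close>; apply this to \<open>h\<close> followed by \<open>h'\<close> reversed.\<close>
  have same: "degree Z3 x y (J x y h) = degree Z3 x y (J x y h')"
    if h: "homogeneous U x y h" "homogeneous U x y h'" for h h'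
  proof -
    have Hom: "h \<in> Hom K x y" "h \<noteq> 0" "h' \<in> Hom K x y" "h' \<noteq> 0"
      using h Piece_in_Hom[OF gU xy] by (auto simp: homogeneous_def)
    let ?w = "[VMor x y h' (-1), VMor x y h 1]"
    have "virtual_morphism K (VMor x y h 1)" "virtual_morphism K (VMor x y h' (-1))"
      using Hom xy by (simp_all add: virtual_morphism_def)
    then have w: "?w \<in> HW K U x x"
      using h by (intro HW_Cons HW_single) (simp_all add: vsource_def vtarget_def)
    then have "walk_degree U ?w \<in> carrier (Gam U)"
      using cU xy unfolding connected_grading_def by blast
    then have "walk_degree Z3 (HW_map J ?w) = 0" using eq[OF w] trivial by simp
    then show ?thesis
      using JPiece[OF h(1)] JPiece[OF h(2)]
      by (auto simp: HW_map_def Gam_Z3 int_pow_integer_mod_group)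
  qed
  obtain d where d: "\<And>h. homogeneous U x y h \<Longrightarrow> J x y h \<in> Piece Z3 d x y"
  proof (cases "\<exists>h. homogeneous U x y h")
    case True
    then obtain h0 where h0: "homogeneous U x y h0" ..
    have "J x y h \<in> Piece Z3 (degree Z3 x y (J x y h0)) x y" if "homogeneous U x y h" for h
      using JPiece[OF that] same[OF that h0] by simp
    then show thesis by (rule that)
  qed blast
  have lin: "linear_automorphism K (\<lambda>b. b) J"
    using J by (simp add: homogeneous_automorphism_def)
  \<comment> \<open>The part of the space that \<open>J\<close> sends into degree \<open>d\<close> contains a spanning set.\<close>
  let ?V = "{v \<in> Hom K x y. J x y v \<in> Piece Z3 d x y}"
  have sub: "subspace (Piece Z3 d x y)" by (rule subspace_Piece[OF xy])
  have J0: "J x y 0 = 0"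
    using linear_automorphism_zero[OF lin xy] zero_in_Hom xy by blast
  have "subspace ?V"
  proof (rule subspaceI)
    show "0 \<in> ?V" using J0 sub zero_in_Hom xy by (simp add: subspace_0)
  next
    fix u v assume "u \<in> ?V" "v \<in> ?V"
    moreover from this have "J x y (u + v) = J x y u + J x y v"
      using linear_automorphismD(2)[OF lin xy] by simp
    ultimately show "u + v \<in> ?V"
      using sub subspace_Hom[OF xy] by (simp add: subspace_add)
  next
    fix c v assume "v \<in> ?V"
    moreover from this have "J x y (Scale K c v) = Scale K c (J x y v)"
      using linear_automorphismD(3)[OF lin xy] by simp
    ultimately show "Scale K c v \<in> ?V"
      using sub subspace_Hom[OF xy] by (simp add: subspace_scale)
  qed
  moreover have "(\<Union>s\<in>carrier (Gam U). Piece U s x y) \<subseteq> ?V"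
  proof
    fix h assume h: "h \<in> (\<Union>s\<in>carrier (Gam U). Piece U s x y)"
    then have "h \<in> Hom K x y" using Piece_in_Hom[OF gU xy] by blast
    moreover have "J x y h \<in> Piece Z3 d x y"
      using h d J0 sub subspace_0 by (cases "h = 0") (auto simp: homogeneous_def)
    ultimately show "h \<in> ?V" by blast
  qed
  ultimately have V: "Hom K x y \<subseteq> ?V"
    by (metis (no_types, lifting) span_minimal spanU)
  have onto: "v \<in> Piece Z3 d x y" if "v \<in> Hom K x y" for v
  proof -
    have "v \<in> J x y ` Hom K x y"
      using that bij_betw_imp_surj_on[OF linear_automorphismD(1)[OF lin xy]] by simp
    then show ?thesis using V by auto
  qed
  have "e \<in> span {e}" "f \<in> span {f}" by (simp_all add: span_base)
  then have "e \<notin> span {f}" "f \<notin> span {e}"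
    using span_lines_inter basis_nonzero by auto
  then show False
    using onto[OF basis_in_Hom(1)] onto[OF basis_in_Hom(2)] basis_nonzero
    by (simp add: Z3_def split: if_splits)
qed

end

theorem proposition35:
  fixes K :: "('o, 'k::field, 'm::ab_group_add) kcat" and x y :: 'o
  assumes "kronecker_category K x y"
  shows "\<not> (\<exists>U :: ('o, 'm, 'g) grading. universal_grading K x U)"
proof -
  interpret kronecker_category K x y by (fact assms)
  have "subspace (Hom K x y)" using subspace_Hom objects by simp
  moreover obtain B where B: "B \<subseteq> Hom K x y" "independent B" "Hom K x y \<subseteq> span B" "card B = 2"
    using basis_exists[of "Hom K x y"] dim_Hom_x_y by auto
  ultimately have "span B = Hom K x y" using span_subspace by blast
  moreover obtain e f where ef: "B = {e, f}" "e \<noteq> f"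
    using B(4) by (auto simp: card_2_iff)
  ultimately interpret kronecker_basis K x y e f
    using B(2) by unfold_locales simp_all
  show ?thesis using no_universal_grading by blast
qed

end
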